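(* Let $\phi:G\to H$ be a surjective homomorphism of groups, where $G$ is finitely generated, with kernel $K$. Suppose that $\operatorname{asdim} H\le n$ and $\operatorname{asdim} K\le k$. Then $\operatorname{asdim} G\le n+k$.
   Context: For a metric space $X$, $\operatorname{asdim} X\le n$ means: for every $D>0$ there exist families $\mathcal{U}_0,\ldots,\mathcal{U}_n$ of uniformly bounded subsets of $X$, each $D$-disjoint (distinct members are at distance $>D$), whose union covers $X$. $\operatorname{asdim}X$ is the smallest such $n$. The finitely generated groups $G$ and $H$ carry left-invariant word metrics of finite generating sets ($\operatorname{asdim}$ does not depend on the choice). The kernel $K$, which need not be finitely generated, carries the metric restricted from $G$. *)

theory Defs
  imports
    "HOL-Algebra.Generated_Groups"
    "HOL-Analysis.Abstract_Metric_Spaces"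
    "HOL-Library.Extended_Nat"
    "HOL-Library.Extended_Real"
begin

section \<open>Asymptotic dimension\<close>

text \<open>The infimum lives in \<^typ>\<open>ereal\<close>, so the distance to the empty set is \<open>\<infinity>\<close>.\<close>

definition set_distance :: "'a metric \<Rightarrow> 'a set \<Rightarrow> 'a set \<Rightarrow> ereal" where
  "set_distance X A B = (INF x\<in>A. INF y\<in>B. ereal (mdist X x y))"

definition disjoint_family_at :: "'a metric \<Rightarrow> real \<Rightarrow> 'a set set \<Rightarrow> bool" where
  "disjoint_family_at X D U \<longleftrightarrow>
     (\<forall>A\<in>U. \<forall>B\<in>U. A \<noteq> B \<longrightarrow> set_distance X A B > ereal D)"

definition uniformly_bounded :: "'a metric \<Rightarrow> 'a set set \<Rightarrow> bool" where
  "uniformly_bounded X U \<longleftrightarrow> (\<exists>R. \<forall>A\<in>U. \<forall>x\<in>A. \<forall>y\<in>A. mdist X x y \<le> R)"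

definition asdim_le :: "'a metric \<Rightarrow> nat \<Rightarrow> bool" where
  "asdim_le X n \<longleftrightarrow>
     (\<forall>D>0. \<exists>U :: nat \<Rightarrow> 'a set set.
        (\<forall>i\<le>n. (\<forall>A\<in>U i. A \<subseteq> mspace X) \<and> uniformly_bounded X (U i) \<and>
                disjoint_family_at X D (U i)) \<and>
        (\<Union>i\<le>n. \<Union>(U i)) = mspace X)"

text \<open>\<open>asdim X = \<infinity>\<close> if no \<^term>\<open>n\<close> works.\<close>

definition asdim :: "'a metric \<Rightarrow> enat" where
  "asdim X = (INF n\<in>{n. asdim_le X n}. enat n)"

lemma asdim_le_mono:
  assumes "asdim_le X m" "m \<le> n"
  shows "asdim_le X n"
  unfolding asdim_le_def
proof (intro allI impI)
  fix D :: real
  assume "D > 0"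
  with assms(1) have "\<exists>U :: nat \<Rightarrow> 'a set set.
        (\<forall>i\<le>m. (\<forall>A\<in>U i. A \<subseteq> mspace X) \<and> uniformly_bounded X (U i) \<and>
                disjoint_family_at X D (U i)) \<and>
        (\<Union>i\<le>m. \<Union>(U i)) = mspace X"
    unfolding asdim_le_def by (elim allE[of _ D] mp)
  then obtain U :: "nat \<Rightarrow> 'a set set" where
    U: "\<forall>i\<le>m. (\<forall>A\<in>U i. A \<subseteq> mspace X) \<and> uniformly_bounded X (U i) \<and>
                disjoint_family_at X D (U i)"
    and cov: "(\<Union>i\<le>m. \<Union>(U i)) = mspace X"
    by (elim exE conjE) (rule that)
  define V where "V = (\<lambda>i. if i \<le> m then U i else {})"
  have "(\<Union>i\<le>n. \<Union>(V i)) = (\<Union>i\<le>m. \<Union>(U i))"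
  proof (intro subset_antisym UN_least)
    show "\<Union>(V i) \<subseteq> (\<Union>i\<le>m. \<Union>(U i))" for i
      by (cases "i \<le> m") (auto simp: V_def)
    show "\<Union>(U i) \<subseteq> (\<Union>i\<le>n. \<Union>(V i))" if "i \<in> {..m}" for i
      using that assms(2) by (intro SUP_upper2[of i]) (auto simp: V_def)
  qed
  moreover have "(\<forall>A\<in>V i. A \<subseteq> mspace X) \<and> uniformly_bounded X (V i) \<and>
                disjoint_family_at X D (V i)" for i
    using U by (cases "i \<le> m") (simp_all add: V_def uniformly_bounded_def disjoint_family_at_def)
  ultimately show "\<exists>U :: nat \<Rightarrow> 'a set set.
        (\<forall>i\<le>n. (\<forall>A\<in>U i. A \<subseteq> mspace X) \<and> uniformly_bounded X (U i) \<and>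
                disjoint_family_at X D (U i)) \<and>
        (\<Union>i\<le>n. \<Union>(U i)) = mspace X"
    using cov by (intro exI[of _ V]) simp
qed

lemma asdim_le_enat_iff: "asdim X \<le> enat n \<longleftrightarrow> asdim_le X n"
proof
  assume le: "asdim X \<le> enat n"
  define N where "N = enat ` {m. asdim_le X m}"
  have "N \<noteq> {}"
  proof
    assume "N = {}"
    then have "asdim X = \<infinity>"
      by (simp only: asdim_def flip: N_def) (simp add: Inf_enat_def)
    with le show False by simp
  qed
  then have "Inf N \<in> N"
    by (metis Inf_enat_def LeastI ex_in_conv)
  then obtain m where "asdim_le X m" "asdim X = enat m"
    by (auto simp: N_def asdim_def)
  then show "asdim_le X n"
    using le asdim_le_mono by fastforce
next
  assume "asdim_le X n"
  then show "asdim X \<le> enat n"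
    by (auto simp: asdim_def intro: INF_lower)
qed


section \<open>Word metrics\<close>

definition word_length :: "('a, 'm) monoid_scheme \<Rightarrow> 'a set \<Rightarrow> 'a \<Rightarrow> nat" where
  "word_length G S g =
     (LEAST l. \<exists>ws. length ws = l \<and> set ws \<subseteq> S \<union> m_inv G ` S \<and>
                    foldr (\<otimes>\<^bsub>G\<^esub>) ws \<one>\<^bsub>G\<^esub> = g)"

text \<open>The value off the carrier only serves the totality requirements of \<^locale>\<open>Metric_space\<close>.\<close>

definition word_dist :: "('a, 'm) monoid_scheme \<Rightarrow> 'a set \<Rightarrow> 'a \<Rightarrow> 'a \<Rightarrow> real" where
  "word_dist G S x y =
     (if x \<in> carrier G \<and> y \<in> carrier G
      then real (word_length G S (inv\<^bsub>G\<^esub> x \<otimes>\<^bsub>G\<^esub> y)) else 0)"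

text \<open>Meaningful when \<^term>\<open>S\<close> generates \<^term>\<open>G\<close>; see \<open>Metric_space_word_dist\<close> below.\<close>

definition word_metric :: "('a, 'm) monoid_scheme \<Rightarrow> 'a set \<Rightarrow> 'a metric" where
  "word_metric G S = metric (carrier G, word_dist G S)"

context group
begin

lemma foldr_mult_closed:
  "set ws \<subseteq> carrier G \<Longrightarrow> foldr (\<otimes>) ws \<one> \<in> carrier G"
  by (induction ws) auto

lemma foldr_mult_append:
  "set us \<subseteq> carrier G \<Longrightarrow> set vs \<subseteq> carrier G \<Longrightarrow>
   foldr (\<otimes>) (us @ vs) \<one> = foldr (\<otimes>) us \<one> \<otimes> foldr (\<otimes>) vs \<one>"
  by (induction us) (auto simp: foldr_mult_closed m_assoc simp del: foldr_append)

lemma foldr_mult_inv: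
  "set ws \<subseteq> carrier G \<Longrightarrow>
   foldr (\<otimes>) (rev (map (m_inv G) ws)) \<one> = inv (foldr (\<otimes>) ws \<one>)"
proof (induction ws)
  case (Cons w ws)
  have "foldr (\<otimes>) (rev (map (m_inv G) ws) @ [inv w]) \<one>
      = foldr (\<otimes>) (rev (map (m_inv G) ws)) \<one> \<otimes> foldr (\<otimes>) [inv w] \<one>"
    by (rule foldr_mult_append) (use Cons.prems in auto)
  then show ?case
    using Cons by (simp add: foldr_mult_closed inv_mult_group del: foldr_append)
qed simp

context
  fixes S assumes S: "S \<subseteq> carrier G"
begin

lemma letters_closed: "S \<union> m_inv G ` S \<subseteq> carrier G"
  using S by auto

lemma ex_word:
  assumes "g \<in> generate G S"
  shows "\<exists>ws. set ws \<subseteq> S \<union> m_inv G ` S \<and> foldr (\<otimes>) ws \<one> = g"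
  using assms
proof (induction rule: generate.induct)
  case one
  show ?case by (rule exI[of _ "[]"]) simp
next
  case (incl h)
  then show ?case using S by (intro exI[of _ "[h]"]) auto
next
  case (inv h)
  then show ?case using S by (intro exI[of _ "[inv h]"]) auto
next
  case (eng h1 h2)
  then obtain us vs where
    "set us \<subseteq> S \<union> m_inv G ` S" "foldr (\<otimes>) us \<one> = h1"
    "set vs \<subseteq> S \<union> m_inv G ` S" "foldr (\<otimes>) vs \<one> = h2"
    by blast
  then show ?case
    using letters_closed foldr_mult_append[of us vs]
    by (intro exI[of _ "us @ vs"]) (auto simp del: foldr_append)
qed

lemma word_length_le:
  "set ws \<subseteq> S \<union> m_inv G ` S \<Longrightarrow> word_length G S (foldr (\<otimes>) ws \<one>) \<le> length ws"
  unfolding word_length_def by (rule Least_le) auto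

lemma word_length_word:
  assumes "g \<in> generate G S"
  obtains ws where "length ws = word_length G S g" "set ws \<subseteq> S \<union> m_inv G ` S"
    "foldr (\<otimes>) ws \<one> = g"
proof -
  have "\<exists>l ws. length ws = l \<and> set ws \<subseteq> S \<union> m_inv G ` S \<and> foldr (\<otimes>) ws \<one> = g"
    using ex_word[OF assms] by blast
  from LeastI_ex[OF this] show thesis
    using that unfolding word_length_def by blast
qed

lemma word_length_inv_le:
  assumes "g \<in> generate G S"
  shows "word_length G S (inv g) \<le> word_length G S g"
proof -
  obtain ws where ws: "length ws = word_length G S g" "set ws \<subseteq> S \<union> m_inv G ` S"
    "foldr (\<otimes>) ws \<one> = g"
    using word_length_word[OF assms] .
  have "set (rev (map (m_inv G) ws)) \<subseteq> S \<union> m_inv G ` S"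
    using ws(2) S by (auto simp: subset_iff)
  from word_length_le[OF this] show ?thesis
    using ws letters_closed foldr_mult_inv[of ws] by auto
qed

lemma word_length_mult_le:
  assumes "g \<in> generate G S" "h \<in> generate G S"
  shows "word_length G S (g \<otimes> h) \<le> word_length G S g + word_length G S h"
proof -
  obtain us where us: "length us = word_length G S g" "set us \<subseteq> S \<union> m_inv G ` S"
    "foldr (\<otimes>) us \<one> = g"
    using word_length_word[OF assms(1)] .
  obtain vs where vs: "length vs = word_length G S h" "set vs \<subseteq> S \<union> m_inv G ` S"
    "foldr (\<otimes>) vs \<one> = h"
    using word_length_word[OF assms(2)] .
  have eq: "foldr (\<otimes>) (us @ vs) \<one> = g \<otimes> h"
    using foldr_mult_append[of us vs] us vs letters_closed by auto
  have "set (us @ vs) \<subseteq> S \<union> m_inv G ` S"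
    using us vs by simp
  from word_length_le[OF this] show ?thesis
    unfolding eq using us vs by simp
qed

lemma word_length_eq_0_iff:
  assumes "g \<in> generate G S"
  shows "word_length G S g = 0 \<longleftrightarrow> g = \<one>"
proof
  assume "word_length G S g = 0"
  then show "g = \<one>"
    using word_length_word[OF assms] by (metis foldr.simps(1) id_apply length_0_conv)
next
  assume "g = \<one>"
  then show "word_length G S g = 0"
    using word_length_le[of "[]"] by simp
qed

lemma Metric_space_word_dist:
  assumes gen: "generate G S = carrier G"
  shows "Metric_space (carrier G) (word_dist G S)"
proof
  have inv_le: "word_length G S (inv x \<otimes> y) \<le> word_length G S (inv y \<otimes> x)"
    if "x \<in> carrier G" "y \<in> carrier G" for x y
    using word_length_inv_le[of "inv y \<otimes> x"] that gen by (simp add: inv_mult_group)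
  show "0 \<le> word_dist G S x y" for x y
    by (simp add: word_dist_def)
  show "word_dist G S x y = word_dist G S y x" for x y
    using inv_le[of x y] inv_le[of y x] by (auto simp: word_dist_def)
  show "word_dist G S x y = 0 \<longleftrightarrow> x = y" if "x \<in> carrier G" "y \<in> carrier G" for x y
  proof -
    have "inv x \<otimes> y = \<one> \<longleftrightarrow> x = y"
      using that by (metis inv_closed inv_equality inv_inv l_inv)
    then show ?thesis
      using that gen word_length_eq_0_iff[of "inv x \<otimes> y"] by (simp add: word_dist_def)
  qed
  show "word_dist G S x z \<le> word_dist G S x y + word_dist G S y z"
    if "x \<in> carrier G" "y \<in> carrier G" "z \<in> carrier G" for x y z
  proof -
    have "(inv x \<otimes> y) \<otimes> (inv y \<otimes> z) = inv x \<otimes> z"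
      using that by (metis inv_closed inv_solve_left m_assoc m_closed)
    then show ?thesis
      using that gen word_length_mult_le[of "inv x \<otimes> y" "inv y \<otimes> z"]
      by (simp add: word_dist_def flip: of_nat_add)
  qed
qed

lemma mspace_word_metric:
  "generate G S = carrier G \<Longrightarrow> mspace (word_metric G S) = carrier G"
  by (simp add: word_metric_def Metric_space.mspace_metric Metric_space_word_dist)

lemma mdist_word_metric:
  "generate G S = carrier G \<Longrightarrow> mdist (word_metric G S) = word_dist G S"
  by (simp add: word_metric_def Metric_space.mdist_metric Metric_space_word_dist)

end

end

end

theory Submission
  imports Defs
begin

text \<open>The argument is that of Brodskiy, Dydak, Levin and Mitra for a coarse map \<open>f : M \<rightarrow> N\<close> whose fibres
  over bounded sets have asymptotic dimension \<open>\<le> k\<close> uniformly. Put \<open>m = n + k + 1\<close>. Kolmogorov's trick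
  yields \<open>m\<close> sets \<open>Y\<^sub>i\<close> in \<open>N\<close> with bounded components that cover every point at least \<open>m - n = k + 1\<close>
  times, and \<open>m\<close> sets \<open>A\<^sub>i\<close> in \<open>M\<close> that cover every point at least \<open>m - k = n + 1\<close> times and whose
  components over each set of the size of a component of \<open>Y\<^sub>i\<close> are bounded. By the pigeonhole principle the
  \<open>m\<close> sets \<open>A\<^sub>i \<inter> f\<^sup>-\<^sup>1(Y\<^sub>i)\<close> cover \<open>M\<close>.\<close>

section \<open>Chains and components at a given scale\<close>

text \<open>The closure is not reflexive, so that related points always lie in \<open>A\<close>;
  reflexivity on \<open>A\<close> is recovered from \<open>mdist x x = 0\<close> when
  \<open>A\<close> lies in the space.\<close>

definition chained :: "'a metric \<Rightarrow> real \<Rightarrow> 'a set \<Rightarrow> ('a \<times> 'a) set" where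
  "chained M r A = {(x, y). x \<in> A \<and> y \<in> A \<and> mdist M x y \<le> r}\<^sup>+"

text \<open>One set replaces a whole disjoint, uniformly bounded family: the members of the family
  become the \<open>r\<close>-components of their union, and \<open>b\<close> is the common bound on
  diameters.\<close>

definition bounded_components :: "'a metric \<Rightarrow> real \<Rightarrow> real \<Rightarrow> 'a set \<Rightarrow> bool" where
  "bounded_components M r b A \<longleftrightarrow> (\<forall>(x, y)\<in>chained M r A. mdist M x y \<le> b)"

lemma mdist_self: "x \<in> mspace M \<Longrightarrow> mdist M x x = 0"
  by simp

lemma chained_step: "x \<in> A \<Longrightarrow> y \<in> A \<Longrightarrow> mdist M x y \<le> r \<Longrightarrow> (x, y) \<in> chained M r A"
  by (auto simp: chained_def)

lemma chained_trans: "(x, y) \<in> chained M r A \<Longrightarrow> (y, z) \<in> chained M r A \<Longrightarrow> (x, z) \<in> chained M r A"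
  unfolding chained_def by (rule trancl_trans)

lemma chained_extend:
  "(x, y) \<in> chained M r A \<Longrightarrow> z \<in> A \<Longrightarrow> mdist M y z \<le> r \<Longrightarrow> y \<in> A \<Longrightarrow> (x, z) \<in> chained M r A"
  by (rule chained_trans[OF _ chained_step])

lemma chained_refl: "x \<in> A \<Longrightarrow> A \<subseteq> mspace M \<Longrightarrow> 0 \<le> r \<Longrightarrow> (x, x) \<in> chained M r A"
  by (rule chained_step) (auto simp: subset_iff mdist_self)

lemma chained_sym: "(x, y) \<in> chained M r A \<Longrightarrow> (y, x) \<in> chained M r A"
  unfolding chained_def
  by (rule symD[OF sym_trancl]) (auto simp: sym_def mdist_commute)

lemma chained_induct [consumes 1, case_names step extend]:
  assumes "(x, y) \<in> chained M r A"
    and "\<And>y. x \<in> A \<Longrightarrow> y \<in> A \<Longrightarrow> mdist M x y \<le> r \<Longrightarrow> P y"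
    and "\<And>y z. (x, y) \<in> chained M r A \<Longrightarrow> P y \<Longrightarrow> y \<in> A \<Longrightarrow> z \<in> A \<Longrightarrow> mdist M y z \<le> r \<Longrightarrow> P z"
  shows "P y"
  using assms(1) unfolding chained_def
proof (induction rule: trancl_induct)
  case (base y)
  then show ?case using assms(2) by simp
next
  case (step y z)
  then show ?case using assms(3)[of y z] by (simp add: chained_def)
qed

lemma chained_in: assumes "(x, y) \<in> chained M r A" shows "x \<in> A" "y \<in> A"
proof -
  show "x \<in> A" using assms by (induction rule: chained_induct) auto
  show "y \<in> A" using assms by (induction rule: chained_induct) auto
qed

lemma chained_image:
  assumes "(x, y) \<in> chained M r A"
    and "\<And>x y. x \<in> A \<Longrightarrow> y \<in> A \<Longrightarrow> mdist M x y \<le> r \<Longrightarrow> mdist N (g x) (g y) \<le> s"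
    and "g ` A \<subseteq> B"
  shows "(g x, g y) \<in> chained N s B"
  using assms(1)
proof (induction rule: chained_induct)
  case (step y)
  then show ?case using assms(3) by (intro chained_step assms(2)) blast+
next
  case (extend y z)
  have "g z \<in> B" "g y \<in> B" using extend assms(3) by blast+
  moreover have "mdist N (g y) (g z) \<le> s" using extend by (intro assms(2))
  ultimately show ?case using extend.IH by (metis chained_extend)
qed

lemma chained_mono:
  "(x, y) \<in> chained M r A \<Longrightarrow> A \<subseteq> B \<Longrightarrow> r \<le> s \<Longrightarrow> (x, y) \<in> chained M s B"
  by (erule chained_image[where g = "\<lambda>x. x"]) simp_all

text \<open>All intermediate points of a chain from \<open>x\<close> lie in the component of
  \<open>x\<close>. Hence a component can itself be the set to which a bound on components is
  applied.\<close>

lemma chained_component: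
  assumes "(x, y) \<in> chained M r A" "A \<subseteq> mspace M" "0 \<le> r"
  shows "(x, y) \<in> chained M r {z. (x, z) \<in> chained M r A}"
  using assms(1)
proof (induction rule: chained_induct)
  case (step y)
  then have "(x, x) \<in> chained M r A" "(x, y) \<in> chained M r A"
    using assms(2,3) by (simp_all add: chained_refl chained_step)
  then show ?case using step by (simp add: chained_step)
next
  case (extend y z)
  then have "(x, z) \<in> chained M r A" by (metis chained_extend)
  with extend show ?case by (metis chained_extend mem_Collect_eq)
qed

section \<open>Sets with bounded components: subsets, distortion and unions\<close>

lemma bounded_components_mono:
  assumes "bounded_components M r b A" "B \<subseteq> A" "s \<le> r" "b \<le> c"
  shows "bounded_components M s c B"
  unfolding bounded_components_def
proof safe
  fix x y assume "(x, y) \<in> chained M s B"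
  then have "(x, y) \<in> chained M r A" using assms(2,3) by (rule chained_mono)
  with assms(1,4) show "mdist M x y \<le> c" by (fastforce simp: bounded_components_def)
qed

lemma bounded_componentsD:
  "bounded_components M r b A \<Longrightarrow> (x, y) \<in> chained M r A \<Longrightarrow> mdist M x y \<le> b"
  by (auto simp: bounded_components_def)

lemma bounded_componentsI:
  "(\<And>x y. (x, y) \<in> chained M r A \<Longrightarrow> mdist M x y \<le> b) \<Longrightarrow> bounded_components M r b A"
  by (auto simp: bounded_components_def)

text \<open>A map that distorts distances by at most \<open>c\<close> sends \<open>r\<close>-chains
  to \<open>(r + c)\<close>-chains, and the bound comes back with a loss of \<open>c\<close>. This
  serves both for enlarging a set by a neighbourhood and for passing from the kernel to a
  neighbourhood of a coset.\<close>

lemma bounded_components_near: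
  assumes bdd: "bounded_components N s b B" and gB: "g ` A \<subseteq> B"
    and g: "\<And>x y. x \<in> A \<Longrightarrow> y \<in> A \<Longrightarrow> \<bar>mdist M x y - mdist N (g x) (g y)\<bar> \<le> c"
    and "r + c \<le> s"
  shows "bounded_components M r (b + c) A"
proof (rule bounded_componentsI)
  fix x y assume xy: "(x, y) \<in> chained M r A"
  have "(g x, g y) \<in> chained N s B"
    using xy
  proof (rule chained_image)
    show "mdist N (g u) (g v) \<le> s" if "u \<in> A" "v \<in> A" "mdist M u v \<le> r" for u v
      using g[OF that(1,2)] that(3) \<open>r + c \<le> s\<close> by linarith
  qed fact
  from bounded_componentsD[OF bdd this] g[of x y] chained_in[OF xy]
  show "mdist M x y \<le> b + c" by fastforce
qed

text \<open>Between two visits to \<open>Q\<close> a chain stays in one component of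
  \<open>P\<close>, of diameter at most \<open>b\<close>. With the steps out and back, consecutive
  visits are at most \<open>b + 2 * r\<close> apart, so the visits form a chain in \<open>Q\<close>
  at that scale.\<close>

lemma bounded_components_Un:
  assumes P: "bounded_components M r b P" and Q: "bounded_components M (b + 2 * r) c Q"
    and sub: "P \<subseteq> mspace M" "Q \<subseteq> mspace M" and r: "0 \<le> r" and b: "0 \<le> b" and c: "0 \<le> c"
  shows "bounded_components M r (2 * (b + c + r)) (P \<union> Q)"
proof (rule bounded_componentsI)
  note comm = mdist_commute[of M]
  have near: "mdist M x y \<le> b + c + r" if xy: "(x, y) \<in> chained M r (P \<union> Q)" and x: "x \<in> Q" for x y
  proof -
    \<comment> \<open>Invariant along the chain from \<open>x\<close> in \<open>Q\<close>: either
      \<open>y\<close> is reached by the coarser chain of visits to \<open>Q\<close>, or such a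
      chain is followed by one step to \<open>w\<close> in \<open>P\<close> and a chain inside
      \<open>P\<close>.\<close>
    let ?J = "\<lambda>y. (x, y) \<in> chained M (b + 2 * r) Q \<or>
      (\<exists>z w. (x, z) \<in> chained M (b + 2 * r) Q \<and> mdist M z w \<le> r \<and> (w, y) \<in> chained M r P)"
    have next_J: "?J z" if "?J y" "y \<in> P \<union> Q" "z \<in> P \<union> Q" "mdist M y z \<le> r" for y z
      using that(1)
    proof
      assume y: "(x, y) \<in> chained M (b + 2 * r) Q"
      show ?thesis
      proof (cases "z \<in> P")
        case True
        then show ?thesis using y that(4) sub(1) r by (blast intro: chained_refl)
      next
        case False
        then have "(x, z) \<in> chained M (b + 2 * r) Q"
          using y that(3,4) b r chained_in[OF y] by (intro chained_extend[OF y]) auto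
        then show ?thesis ..
      qed
    next
      assume "\<exists>z w. (x, z) \<in> chained M (b + 2 * r) Q \<and> mdist M z w \<le> r \<and> (w, y) \<in> chained M r P"
      then obtain v w where v: "(x, v) \<in> chained M (b + 2 * r) Q" "mdist M v w \<le> r"
        and w: "(w, y) \<in> chained M r P" by blast
      show ?thesis
      proof (cases "z \<in> P")
        case True
        then show ?thesis using v chained_extend[OF w True that(4)] chained_in[OF w] by blast
      next
        \<comment> \<open>The chain returns to \<open>Q\<close>: the last visit \<open>v\<close> and
          the new point \<open>z\<close> are at distance at most \<open>r + b + r\<close>.\<close>
        case False
        with that have z: "z \<in> Q" by blast
        have "mdist M w y \<le> b" using bounded_componentsD[OF P w] .
        moreover have "mdist M v z \<le> mdist M v w + mdist M w z" "mdist M w z \<le> mdist M w y + mdist M y z"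
          using chained_in[OF v(1)] chained_in[OF w] z sub by (auto intro!: mdist_triangle)
        ultimately have "mdist M v z \<le> b + 2 * r" using v(2) that(4) by linarith
        then show ?thesis using chained_extend[OF v(1) z] chained_in[OF v(1)] by blast
      qed
    qed
    have "(x, x) \<in> chained M (b + 2 * r) Q" using x sub r b by (intro chained_refl) auto
    then have "?J y"
      using xy
    proof (induction rule: chained_induct[OF xy])
      case (1 y)
      then show ?case using next_J[of x y] by blast
    next
      case (2 y z)
      then show ?case using next_J[of y z] by blast
    qed
    then show ?thesis
    proof
      assume "(x, y) \<in> chained M (b + 2 * r) Q"
      from bounded_componentsD[OF Q this] show ?thesis using r b by simp
    next
      assume "\<exists>z w. (x, z) \<in> chained M (b + 2 * r) Q \<and> mdist M z w \<le> r \<and> (w, y) \<in> chained M r P"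
      then obtain v w where v: "(x, v) \<in> chained M (b + 2 * r) Q" "mdist M v w \<le> r"
        and w: "(w, y) \<in> chained M r P" by blast
      have "mdist M x y \<le> mdist M x v + mdist M v y" "mdist M v y \<le> mdist M v w + mdist M w y"
        using chained_in[OF v(1)] chained_in[OF w] sub by (auto intro!: mdist_triangle)
      then show ?thesis
        using bounded_componentsD[OF P w] bounded_componentsD[OF Q v(1)] v(2) by linarith
    qed
  qed
  fix x y assume xy: "(x, y) \<in> chained M r (P \<union> Q)"
  \<comment> \<open>Either the chain never meets \<open>Q\<close>, or a visited point
    \<open>p\<close> of \<open>Q\<close> serves as a pivot; using \<open>near\<close> from
    \<open>p\<close> to both ends gives the factor 2.\<close>
  have "(x, y) \<in> chained M r P \<or> (\<exists>p\<in>Q. (x, p) \<in> chained M r (P \<union> Q))"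
    using xy
  proof (induction rule: chained_induct)
    case (step y)
    have "(x, x) \<in> chained M r (P \<union> Q)" using step(1) sub r by (intro chained_refl) auto
    moreover have "(x, y) \<in> chained M r (P \<union> Q)" using step by (intro chained_step)
    moreover have "(x, y) \<in> chained M r P" if "x \<in> P" "y \<in> P"
      using that step(3) by (rule chained_step)
    ultimately show ?case using step(1,2) by blast
  next
    case (extend y z)
    then show ?case by (cases "z \<in> Q") (auto intro: chained_extend dest: chained_in)
  qed
  then show "mdist M x y \<le> 2 * (b + c + r)"
  proof
    assume "(x, y) \<in> chained M r P"
    from bounded_componentsD[OF P this] show ?thesis using r b c by simp
  next
    assume "\<exists>p\<in>Q. (x, p) \<in> chained M r (P \<union> Q)"
    then obtain p where p: "p \<in> Q" "(x, p) \<in> chained M r (P \<union> Q)" by blast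
    have "mdist M x y \<le> mdist M x p + mdist M p y"
      using chained_in[OF xy] p(1) sub by (intro mdist_triangle) auto
    moreover have "mdist M p x \<le> b + c + r" "mdist M p y \<le> b + c + r"
      using near[OF chained_sym[OF p(2)] p(1)] near[OF chained_trans[OF chained_sym[OF p(2)] xy] p(1)] .
    ultimately show ?thesis unfolding comm[of x p] distrib_left by linarith
  qed
qed

section \<open>Disjoint families versus components of a single set\<close>

lemma bounded_components_Union:
  assumes R: "\<And>A x y. A \<in> U \<Longrightarrow> x \<in> A \<Longrightarrow> y \<in> A \<Longrightarrow> mdist M x y \<le> R"
    and D: "disjoint_family_at M D U"
  shows "bounded_components M D R (\<Union>U)"
proof (rule bounded_componentsI)
  \<comment> \<open>Steps of length at most \<open>D\<close> cannot pass between distinct members,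
    so each component lies in one member.\<close>
  have same: "A = B" if "A \<in> U" "B \<in> U" "x \<in> A" "y \<in> B" "mdist M x y \<le> D" for A B x y
  proof (rule ccontr)
    assume "A \<noteq> B"
    with D that have "ereal D < set_distance M A B" by (auto simp: disjoint_family_at_def)
    also have "set_distance M A B \<le> ereal (mdist M x y)"
      unfolding set_distance_def using that by (meson INF_lower2 order_refl)
    finally show False using that(5) by simp
  qed
  fix x y assume "(x, y) \<in> chained M D (\<Union>U)"
  then have "\<exists>A\<in>U. x \<in> A \<and> y \<in> A"
  proof (induction rule: chained_induct)
    case (step y)
    then show ?case using same by blast
  next
    case (extend y z)
    then show ?case using same by blast
  qed
  with R show "mdist M x y \<le> R" by blast
qed

lemma asdim_leD:
  assumes "asdim_le M n" "D > 0"
  obtains A R where "\<And>i. i \<le> n \<Longrightarrow> A i \<subseteq> mspace M"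
    "\<And>i. i \<le> n \<Longrightarrow> bounded_components M D R (A i)" "(\<Union>i\<le>n. A i) = mspace M"
proof -
  obtain U :: "nat \<Rightarrow> 'a set set" where U: "\<forall>i\<le>n. (\<forall>A\<in>U i. A \<subseteq> mspace M) \<and> uniformly_bounded M (U i) \<and>
      disjoint_family_at M D (U i)" "(\<Union>i\<le>n. \<Union>(U i)) = mspace M"
    using assms unfolding asdim_le_def by meson
  have "\<forall>i. \<exists>R. i \<le> n \<longrightarrow> (\<forall>A\<in>U i. \<forall>x\<in>A. \<forall>y\<in>A. mdist M x y \<le> R)"
    using U by (auto simp: uniformly_bounded_def)
  then obtain R where R: "\<And>i A x y. i \<le> n \<Longrightarrow> A \<in> U i \<Longrightarrow> x \<in> A \<Longrightarrow> y \<in> A \<Longrightarrow> mdist M x y \<le> R i"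
    by metis
  show thesis
  proof
    show "\<Union>(U i) \<subseteq> mspace M" if "i \<le> n" for i using U(1) that by blast
    \<comment> \<open>The bounds of the \<open>n + 1\<close> families are merged into one.\<close>
    show "bounded_components M D (Max (R ` {..n})) (\<Union>(U i))" if i: "i \<le> n" for i
    proof (rule bounded_components_mono)
      show "bounded_components M D (R i) (\<Union>(U i))"
        using U(1) R i by (intro bounded_components_Union) auto
    qed (use i in auto)
  qed (use U in auto)
qed

text \<open>Converse passage: the families consist of the components of the sets \<open>A i\<close>;
  distinct components are automatically far apart.\<close>

lemma asdim_leI:
  assumes "\<And>D. D > 0 \<Longrightarrow> \<exists>A. (\<forall>i\<le>n. A i \<subseteq> mspace M \<and> (\<exists>b. bounded_components M D b (A i))) \<and>
      (\<Union>i\<le>n. A i) = mspace M"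
  shows "asdim_le M n"
  unfolding asdim_le_def
proof (intro allI impI)
  fix D :: real assume D: "D > 0"
  \<comment> \<open>Disjointness is a strict inequality for an infimum, hence the larger scale.\<close>
  obtain A where A: "\<And>i. i \<le> n \<Longrightarrow> A i \<subseteq> mspace M"
    "\<And>i. i \<le> n \<Longrightarrow> \<exists>b. bounded_components M (D + 1) b (A i)" "(\<Union>i\<le>n. A i) = mspace M"
    using assms[of "D + 1"] D by auto
  define comp where "comp = (\<lambda>i x. {y. (x, y) \<in> chained M (D + 1) (A i)})"
  define U where "U = (\<lambda>i. comp i ` A i)"
  have "(\<forall>B\<in>U i. B \<subseteq> mspace M) \<and> uniformly_bounded M (U i) \<and> disjoint_family_at M D (U i)"
    if i: "i \<le> n" for i
  proof (intro conjI)
    show "\<forall>B\<in>U i. B \<subseteq> mspace M"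
      using A(1)[OF i] by (auto simp: U_def comp_def dest: chained_in)
    obtain b where b: "bounded_components M (D + 1) b (A i)" using A(2)[OF i] ..
    show "uniformly_bounded M (U i)"
      unfolding uniformly_bounded_def U_def comp_def
      by (intro exI[of _ b]) (auto intro: bounded_componentsD[OF b] chained_trans chained_sym)
    show "disjoint_family_at M D (U i)"
      unfolding disjoint_family_at_def
    proof (intro ballI impI)
      fix B C assume BC: "B \<in> U i" "C \<in> U i" "B \<noteq> C"
      then obtain u v where u: "B = comp i u" and v: "C = comp i v" by (auto simp: U_def)
      have far: "D + 1 \<le> mdist M x y" if "x \<in> B" "y \<in> C" for x y
      proof (rule ccontr)
        assume "\<not> D + 1 \<le> mdist M x y"
        moreover have x: "(u, x) \<in> chained M (D + 1) (A i)" and y: "(v, y) \<in> chained M (D + 1) (A i)"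
          using that u v by (auto simp: comp_def)
        ultimately have "(x, y) \<in> chained M (D + 1) (A i)"
          by (intro chained_step) (auto dest: chained_in)
        with x y have "(u, v) \<in> chained M (D + 1) (A i)"
          by (meson chained_trans chained_sym)
        then have "B = C"
          unfolding u v comp_def by (auto intro: chained_trans chained_sym)
        with BC show False by simp
      qed
      have "ereal D < ereal (D + 1)" by simp
      also have "\<dots> \<le> set_distance M B C"
        unfolding set_distance_def using far by (intro INF_greatest) simp
      finally show "ereal D < set_distance M B C" .
    qed
  qed
  moreover have "\<Union>(U i) = A i" if "i \<le> n" for i
    using A(1)[OF that] D by (auto simp: U_def comp_def dest: chained_in intro!: bexI chained_refl)
  then have "(\<Union>i\<le>n. \<Union>(U i)) = mspace M" using A(3) by simp
  ultimately show "\<exists>U :: nat \<Rightarrow> 'a set set.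
        (\<forall>i\<le>n. (\<forall>A\<in>U i. A \<subseteq> mspace M) \<and> uniformly_bounded M (U i) \<and>
                disjoint_family_at M D (U i)) \<and>
        (\<Union>i\<le>n. \<Union>(U i)) = mspace M"
    by (intro exI[of _ U]) simp
qed


section \<open>Coverings of the domain of a map\<close>

text \<open>Taking \<open>R = 0\<close> and a constant map \<open>f\<close>, this is boundedness of all \<open>r\<close>-components of \<open>A\<close>.\<close>

definition fibre_bounded :: "'a metric \<Rightarrow> 'b metric \<Rightarrow> ('a \<Rightarrow> 'b) \<Rightarrow> real \<Rightarrow> real \<Rightarrow> 'a set \<Rightarrow> bool" where
  "fibre_bounded M N f r R A \<longleftrightarrow>
     (\<exists>b. \<forall>B\<subseteq>A. (\<forall>x\<in>B. \<forall>y\<in>B. mdist N (f x) (f y) \<le> R) \<longrightarrow> bounded_components M r b B)"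

text \<open>In coarse geometry such maps are called bornologous.\<close>

definition coarse_map :: "'a metric \<Rightarrow> 'b metric \<Rightarrow> ('a \<Rightarrow> 'b) \<Rightarrow> bool" where
  "coarse_map M N f \<longleftrightarrow> f ` mspace M \<subseteq> mspace N \<and>
     (\<forall>r. \<exists>s. \<forall>x\<in>mspace M. \<forall>y\<in>mspace M. mdist M x y \<le> r \<longrightarrow> mdist N (f x) (f y) \<le> s)"

lemma fibre_boundedI:
  assumes "\<And>B. B \<subseteq> A \<Longrightarrow> (\<And>x y. x \<in> B \<Longrightarrow> y \<in> B \<Longrightarrow> mdist N (f x) (f y) \<le> R)
    \<Longrightarrow> bounded_components M r b B"
  shows "fibre_bounded M N f r R A"
  unfolding fibre_bounded_def
proof (intro exI[of _ b] allI impI)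
  fix B assume "B \<subseteq> A" "\<forall>x\<in>B. \<forall>y\<in>B. mdist N (f x) (f y) \<le> R"
  then show "bounded_components M r b B" using assms[of B] by simp
qed

section \<open>Kolmogorov's trick\<close>

lemma finite_uniform_bound:
  fixes P :: "'i \<Rightarrow> real \<Rightarrow> bool"
  assumes "finite I" "\<And>i. i \<in> I \<Longrightarrow> \<exists>b. P i b" "\<And>i b c. P i b \<Longrightarrow> b \<le> c \<Longrightarrow> P i c"
  obtains b where "0 \<le> b" "\<And>i. i \<in> I \<Longrightarrow> P i b"
proof -
  obtain \<beta> where \<beta>: "\<And>i. i \<in> I \<Longrightarrow> P i (\<beta> i)" using assms(2) by metis
  show thesis
  proof
    \<comment> \<open>The inserted 0 makes the maximum nonnegative, and meaningful for empty
      \<open>I\<close>.\<close>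
    show "P i (Max (insert 0 (\<beta> ` I)))" if "i \<in> I" for i
      using assms(1) that by (intro assms(3)[OF \<beta>[OF that]]) auto
  qed (use assms(1) in auto)
qed

lemma fibre_bounded_finite:
  assumes "finite I" "\<And>i. i \<in> I \<Longrightarrow> fibre_bounded M N f r R (A i)"
  obtains b where "0 \<le> b" "\<And>i B. i \<in> I \<Longrightarrow> B \<subseteq> A i \<Longrightarrow>
    (\<And>x y. x \<in> B \<Longrightarrow> y \<in> B \<Longrightarrow> mdist N (f x) (f y) \<le> R) \<Longrightarrow> bounded_components M r b B"
proof -
  let ?P = "\<lambda>i b. \<forall>B\<subseteq>A i. (\<forall>x\<in>B. \<forall>y\<in>B. mdist N (f x) (f y) \<le> R) \<longrightarrow> bounded_components M r b B"
  obtain b where "0 \<le> b" and b: "\<And>i. i \<in> I \<Longrightarrow> ?P i b"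
  proof (rule finite_uniform_bound[OF assms(1), of ?P])
    show "\<exists>b. ?P i b" if "i \<in> I" for i using assms(2)[OF that] by (simp add: fibre_bounded_def)
    show "?P i c" if "?P i b" "b \<le> c" for i b c
      using that bounded_components_mono[OF _ order_refl order_refl that(2)] by blast
  qed blast
  then show thesis by (intro that[of b]) auto
qed

text \<open>Kolmogorov's trick: the new set \<open>W\<close> collects the points which even the enlarged sets cover
  only the guaranteed \<open>m - n\<close> times; along a short chain in \<open>W\<close> the sets covering a point do not change.\<close>

lemma kolmogorov_step:
  fixes A :: "nat \<Rightarrow> 'a set"
  assumes f: "f ` mspace M \<subseteq> mspace N"
    and \<rho>: "\<And>x y. x \<in> mspace M \<Longrightarrow> y \<in> mspace M \<Longrightarrow> mdist M x y \<le> r \<Longrightarrow> mdist N (f x) (f y) \<le> \<rho>"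
    and "n < m" "0 < r" "0 \<le> \<rho>"
    and A: "\<And>i. i < m \<Longrightarrow> A i \<subseteq> mspace M"
      "\<And>i. i < m \<Longrightarrow> fibre_bounded M N f (3 * r) (R + 2 * \<rho>) (A i)"
    and cov: "\<And>x. x \<in> mspace M \<Longrightarrow> m \<le> card {i. i < m \<and> x \<in> A i} + n"
  obtains A' :: "nat \<Rightarrow> 'a set" where "\<And>i. i < Suc m \<Longrightarrow> A' i \<subseteq> mspace M"
    "\<And>i. i < Suc m \<Longrightarrow> fibre_bounded M N f r R (A' i)"
    "\<And>x. x \<in> mspace M \<Longrightarrow> Suc m \<le> card {i. i < Suc m \<and> x \<in> A' i} + n"
proof -
  \<comment> \<open>\<open>A1 i\<close> is the \<open>r\<close>-neighbourhood of \<open>A i\<close>;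
    \<open>I x\<close> and \<open>I1 x\<close> list the original and the enlarged sets containing
    \<open>x\<close>.\<close>
  define A1 where "A1 = (\<lambda>i. {x \<in> mspace M. \<exists>a\<in>A i. mdist M x a \<le> r})"
  define I where "I = (\<lambda>x. {i. i < m \<and> x \<in> A i})"
  define I1 where "I1 = (\<lambda>x. {i. i < m \<and> x \<in> A1 i})"
  define W where "W = {x \<in> mspace M. card (I1 x) + n \<le> m}"
  define A' where "A' = (\<lambda>i. if i < m then A1 i else W)"
  have fin: "finite (I1 x)" for x by (simp add: I1_def)
  have near: "i \<in> I1 x" if "i \<in> I y" "x \<in> mspace M" "mdist M x y \<le> r" for i x y
    using that by (auto simp: I_def I1_def A1_def)
  have I_sub: "I x \<subseteq> I1 x" if "x \<in> mspace M" for x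
    using near[of _ x x] that \<open>0 < r\<close> by (auto simp: mdist_self)
  \<comment> \<open>On \<open>W\<close> the inequalities
    \<open>m - n \<le> card (I x) \<le> card (I1 x) \<le> m - n\<close> collapse, and
    \<open>m - n\<close> is positive.\<close>
  have I_W: "I x = I1 x" "I x \<noteq> {}" if x: "x \<in> W" for x
  proof -
    have "x \<in> mspace M" "card (I1 x) + n \<le> m" "m \<le> card (I x) + n"
      using x cov by (auto simp: W_def I_def)
    with I_sub[of x] fin[of x] show "I x = I1 x" by (intro card_seteq) auto
    show "I x \<noteq> {}" using \<open>m \<le> card (I x) + n\<close> \<open>n < m\<close> by auto
  qed
  \<comment> \<open>Replacing two points of \<open>A1 i\<close> by points of \<open>A i\<close>
    within \<open>r\<close> changes their distance by at most \<open>2 * r\<close> and that of their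
    images by at most \<open>2 * \<rho>\<close>; hence the scale \<open>3 * r\<close> and the size
    \<open>R + 2 * \<rho>\<close>.\<close>
  obtain b where b: "0 \<le> b" "\<And>i B. i \<in> {..<m} \<Longrightarrow> B \<subseteq> A i \<Longrightarrow>
      (\<And>x y. x \<in> B \<Longrightarrow> y \<in> B \<Longrightarrow> mdist N (f x) (f y) \<le> R + 2 * \<rho>) \<Longrightarrow>
      bounded_components M (3 * r) b B"
    by (rule fibre_bounded_finite[of "{..<m}" M N f "3 * r" "R + 2 * \<rho>" A, OF finite_lessThan]) (use A(2) in auto)
  show thesis
  proof
    show A'_sub: "A' i \<subseteq> mspace M" for i by (auto simp: A'_def A1_def W_def)
    show "fibre_bounded M N f r R (A' i)" if "i < Suc m" for i
    proof (rule fibre_boundedI)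
      fix B assume B: "B \<subseteq> A' i" "\<And>x y. x \<in> B \<Longrightarrow> y \<in> B \<Longrightarrow> mdist N (f x) (f y) \<le> R"
      show "bounded_components M r (b + 2 * r) B"
      proof (cases "i < m")
        case True
        then have "\<forall>x\<in>B. \<exists>a\<in>A i. mdist M x a \<le> r" using B(1) by (auto simp: A'_def A1_def)
        then obtain a where a: "\<And>x. x \<in> B \<Longrightarrow> a x \<in> A i" "\<And>x. x \<in> B \<Longrightarrow> mdist M x (a x) \<le> r"
          by metis
        have Bm: "x \<in> mspace M" "a x \<in> mspace M" if "x \<in> B" for x
          using that B(1) A'_sub a(1) A(1)[OF True] by blast+
        have "bounded_components M (3 * r) b (a ` B)"
        proof (rule b(2))
          show "mdist N (f u) (f v) \<le> R + 2 * \<rho>" if uv: "u \<in> a ` B" "v \<in> a ` B" for u v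
          proof -
            obtain x y where xy: "x \<in> B" "y \<in> B" "u = a x" "v = a y" using uv by blast
            have m: "f x \<in> mspace N" "f y \<in> mspace N" "f u \<in> mspace N" "f v \<in> mspace N"
              using Bm xy f by blast+
            have "mdist N (f x) (f u) \<le> \<rho>" "mdist N (f y) (f v) \<le> \<rho>"
              using Bm xy a by (auto intro: \<rho>)
            moreover have "mdist N (f u) (f v) \<le> mdist N (f u) (f x) + mdist N (f x) (f v)"
              "mdist N (f x) (f v) \<le> mdist N (f x) (f y) + mdist N (f y) (f v)"
              using m by (auto intro!: mdist_triangle)
            ultimately show ?thesis
              using B(2)[OF xy(1,2)] mdist_commute[of N "f u" "f x"] by linarith
          qed
        qed (use a True in auto)
        then show ?thesis
        proof (rule bounded_components_near[of _ _ _ _ a])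
          fix x y assume xy: "x \<in> B" "y \<in> B"
          have "mdist M x y \<le> mdist M x (a x) + mdist M (a x) y"
            "mdist M (a x) y \<le> mdist M (a x) (a y) + mdist M (a y) y"
            "mdist M (a x) (a y) \<le> mdist M (a x) x + mdist M x (a y)"
            "mdist M x (a y) \<le> mdist M x y + mdist M y (a y)"
            using Bm xy by (auto intro!: mdist_triangle)
          then show "\<bar>mdist M x y - mdist M (a x) (a y)\<bar> \<le> 2 * r"
            using a(2)[OF xy(1)] a(2)[OF xy(2)] mdist_commute[of M x "a x"] mdist_commute[of M y "a y"]
            by linarith
        qed auto
      next
        case False
        then have BW: "B \<subseteq> W" using B(1) by (simp add: A'_def)
        \<comment> \<open>A set \<open>A i\<close> containing \<open>y\<close> contains
          \<open>x\<close> after enlargement, and enlargement adds no index on \<open>W\<close>;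
          likewise with \<open>x\<close> and \<open>y\<close> exchanged.\<close>
        have I_eq: "I x = I y" if "x \<in> B" "y \<in> B" "mdist M x y \<le> r" for x y
        proof -
          have xy: "x \<in> W" "y \<in> W" "x \<in> mspace M" "y \<in> mspace M" using that BW by (auto simp: W_def)
          have "I y \<subseteq> I1 x" "I x \<subseteq> I1 y"
            using near[of _ y x] near[of _ x y] that(3) xy mdist_commute[of M x y] by auto
          then show ?thesis using I_W xy by blast
        qed
        show ?thesis
        proof (rule bounded_componentsI)
          fix x y assume xy: "(x, y) \<in> chained M r B"
          have "x \<in> B" using chained_in[OF xy] by simp
          \<comment> \<open>Since \<open>I\<close> is constant along the chain, one index
            \<open>i\<close> serves for all of it and the chain lies in \<open>A i\<close>.\<close>
          then obtain i where i: "i \<in> I x" using I_W BW by blast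
          have "(x, y) \<in> chained M r (B \<inter> A i) \<and> I y = I x"
            using xy
          proof (induction rule: chained_induct)
            case (step y)
            then have "I y = I x" using I_eq by blast
            with step i show ?case by (auto simp: I_def intro!: chained_step)
          next
            case (extend y z)
            then have "I z = I x" using I_eq by blast
            with extend i have "y \<in> B \<inter> A i" "z \<in> B \<inter> A i" by (auto simp: I_def)
            with extend \<open>I z = I x\<close> show ?case by (meson chained_extend)
          qed
          then have "(x, y) \<in> chained M (3 * r) (B \<inter> A i)"
            using \<open>0 < r\<close> chained_mono[of x y M r "B \<inter> A i" "B \<inter> A i" "3 * r"] by simp
          moreover have "bounded_components M (3 * r) b (B \<inter> A i)"
          proof (rule b(2))
            fix x y assume "x \<in> B \<inter> A i" "y \<in> B \<inter> A i"
            then show "mdist N (f x) (f y) \<le> R + 2 * \<rho>" using B(2)[of x y] \<open>0 \<le> \<rho>\<close> by auto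
          qed (use i in \<open>auto simp: I_def\<close>)
          ultimately show "mdist M x y \<le> b + 2 * r"
            using bounded_componentsD \<open>0 < r\<close> by fastforce
        qed
      qed
    qed
    show "Suc m \<le> card {i. i < Suc m \<and> x \<in> A' i} + n" if x: "x \<in> mspace M" for x
    \<comment> \<open>In \<open>W\<close> the new set adds one to the count \<open>m - n\<close>;
      outside \<open>W\<close> the enlarged sets already cover more than \<open>m - n\<close>
      times.\<close>
    proof (cases "x \<in> W")
      case True
      then have "{i. i < Suc m \<and> x \<in> A' i} = insert m (I1 x)"
        by (auto simp: A'_def I1_def split: if_splits)
      moreover have "m \<notin> I1 x" by (simp add: I1_def)
      moreover have "m \<le> card (I1 x) + n"
        using cov[OF x] I_W[OF True] by (simp add: I_def)
      ultimately show ?thesis using fin by simp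
    next
      case False
      then have "{i. i < Suc m \<and> x \<in> A' i} = I1 x"
        by (auto simp: A'_def I1_def split: if_splits)
      moreover have "m < card (I1 x) + n" using False x by (simp add: W_def)
      ultimately show ?thesis by simp
    qed
  qed
qed

text \<open>Iterates the step from \<open>m = n + 1\<close>. Each step consumes a covering at a
  larger scale and a larger fibre size, so \<open>base\<close> is asked for all \<open>r\<close> and
  \<open>R\<close>, and both are generalised in the induction.\<close>

lemma kolmogorov:
  assumes f: "coarse_map M N f"
    and base: "\<And>r R. 0 < r \<Longrightarrow> \<exists>A. (\<forall>i\<le>n. A i \<subseteq> mspace M \<and> fibre_bounded M N f r R (A i)) \<and>
      mspace M \<subseteq> (\<Union>i\<le>n. A i)"
    and "n < m" "0 < r"
  shows "\<exists>A. (\<forall>i<m. A i \<subseteq> mspace M \<and> fibre_bounded M N f r R (A i)) \<and>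
      (\<forall>x\<in>mspace M. m \<le> card {i. i < m \<and> x \<in> A i} + n)"
  using Suc_leI[OF \<open>n < m\<close>] \<open>0 < r\<close>
proof (induction m arbitrary: r R rule: dec_induct)
  case base
  obtain A where A: "\<forall>i\<le>n. A i \<subseteq> mspace M \<and> fibre_bounded M N f r R (A i)"
    "mspace M \<subseteq> (\<Union>i\<le>n. A i)"
    using assms(2)[OF base, of R] by (elim exE conjE) (rule that)
  \<comment> \<open>For \<open>m = n + 1\<close> the multiplicity claim says only that each point is
    covered.\<close>
  have "Suc n \<le> card {i. i < Suc n \<and> x \<in> A i} + n" if "x \<in> mspace M" for x
  proof -
    have "{i. i < Suc n \<and> x \<in> A i} \<noteq> {}" using A(2) that by (auto simp: less_Suc_eq_le)
    then have "card {i. i < Suc n \<and> x \<in> A i} \<noteq> 0" by (subst card_0_eq) auto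
    then show ?thesis by linarith
  qed
  with A(1) show ?case by (intro exI[of _ A]) (simp add: less_Suc_eq_le)
next
  case (step m)
  have fN: "f ` mspace M \<subseteq> mspace N" and "\<exists>s. \<forall>x\<in>mspace M. \<forall>y\<in>mspace M. mdist M x y \<le> r \<longrightarrow> mdist N (f x) (f y) \<le> s"
    using f by (simp_all add: coarse_map_def)
  then obtain \<rho> where \<rho>: "\<forall>x\<in>mspace M. \<forall>y\<in>mspace M. mdist M x y \<le> r \<longrightarrow> mdist N (f x) (f y) \<le> \<rho>"
    by (elim exE) (rule that)
  \<comment> \<open>The bound \<open>\<rho>\<close> is truncated at 0, since over an empty space it
    may be negative.\<close>
  have "\<exists>A. (\<forall>i<m. A i \<subseteq> mspace M \<and> fibre_bounded M N f (3 * r) (R + 2 * max 0 \<rho>) (A i)) \<and>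
      (\<forall>x\<in>mspace M. m \<le> card {i. i < m \<and> x \<in> A i} + n)"
    by (rule step.IH) (use step.prems in simp)
  then obtain A where A: "\<forall>i<m. A i \<subseteq> mspace M \<and> fibre_bounded M N f (3 * r) (R + 2 * max 0 \<rho>) (A i)"
    "\<forall>x\<in>mspace M. m \<le> card {i. i < m \<and> x \<in> A i} + n"
    by (elim exE conjE) (rule that)
  show ?case
  proof (rule kolmogorov_step[of f M N r "max 0 \<rho>" n m A R])
    fix A' assume "\<And>i. i < Suc m \<Longrightarrow> A' i \<subseteq> mspace M"
      "\<And>i. i < Suc m \<Longrightarrow> fibre_bounded M N f r R (A' i)"
      "\<And>x. x \<in> mspace M \<Longrightarrow> Suc m \<le> card {i. i < Suc m \<and> x \<in> A' i} + n"
    then show ?case by (intro exI[of _ A'] conjI allI impI ballI)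
  next
    show "mdist N (f x) (f y) \<le> max 0 \<rho>"
      if "x \<in> mspace M" "y \<in> mspace M" "mdist M x y \<le> r" for x y
      using \<rho> that by (simp add: le_max_iff_disj)
  qed (use fN A step.hyps step.prems in simp_all)
qed


section \<open>The Hurewicz theorem\<close>

text \<open>The covers are merged index by index through \<open>bounded_components_Un\<close>. The
  scale \<open>b + 2 * r\<close> for \<open>T\<close> depends on the bound \<open>b\<close> found
  for \<open>S\<close>, so covers are required at every scale, while \<open>R\<close> stays
  fixed.\<close>

lemma fibre_cover_Un:
  fixes k :: nat
  assumes S: "\<And>r. 0 < r \<Longrightarrow> \<exists>A. (\<forall>i\<le>k. A i \<subseteq> mspace M \<and> fibre_bounded M N f r R (A i)) \<and>
      S \<subseteq> (\<Union>i\<le>k. A i)"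
    and T: "\<And>r. 0 < r \<Longrightarrow> \<exists>A. (\<forall>i\<le>k. A i \<subseteq> mspace M \<and> fibre_bounded M N f r R (A i)) \<and>
      T \<subseteq> (\<Union>i\<le>k. A i)"
    and r: "0 < r"
  shows "\<exists>A. (\<forall>i\<le>k. A i \<subseteq> mspace M \<and> fibre_bounded M N f r R (A i)) \<and> S \<union> T \<subseteq> (\<Union>i\<le>k. A i)"
proof -
  obtain A where A: "\<forall>i\<le>k. A i \<subseteq> mspace M \<and> fibre_bounded M N f r R (A i)" "S \<subseteq> (\<Union>i\<le>k. A i)"
    using S[OF r] by (elim exE conjE) (rule that)
  obtain b where b: "0 \<le> b" "\<And>i B. i \<in> {..k} \<Longrightarrow> B \<subseteq> A i \<Longrightarrow>
      (\<And>x y. x \<in> B \<Longrightarrow> y \<in> B \<Longrightarrow> mdist N (f x) (f y) \<le> R) \<Longrightarrow> bounded_components M r b B"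
    by (rule fibre_bounded_finite[of "{..k}" M N f r R A, OF finite_atMost]) (use A in simp_all)
  have "0 < b + 2 * r" using b(1) r by simp
  note T_ex = T[OF this]
  obtain C where C: "\<forall>i\<le>k. C i \<subseteq> mspace M \<and> fibre_bounded M N f (b + 2 * r) R (C i)"
      "T \<subseteq> (\<Union>i\<le>k. C i)"
    using T_ex by (elim exE conjE) (rule that)
  obtain c where c: "0 \<le> c" "\<And>i B. i \<in> {..k} \<Longrightarrow> B \<subseteq> C i \<Longrightarrow>
      (\<And>x y. x \<in> B \<Longrightarrow> y \<in> B \<Longrightarrow> mdist N (f x) (f y) \<le> R) \<Longrightarrow> bounded_components M (b + 2 * r) c B"
    by (rule fibre_bounded_finite[of "{..k}" M N f "b + 2 * r" R C, OF finite_atMost]) (use C in simp_all)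
  have "fibre_bounded M N f r R (A i \<union> C i)" if i: "i \<le> k" for i
  proof (rule fibre_boundedI)
    fix B assume B: "B \<subseteq> A i \<union> C i" "\<And>x y. x \<in> B \<Longrightarrow> y \<in> B \<Longrightarrow> mdist N (f x) (f y) \<le> R"
    have "bounded_components M r (2 * (b + c + r)) ((B \<inter> A i) \<union> (B \<inter> C i))"
    proof (rule bounded_components_Un)
      show "bounded_components M r b (B \<inter> A i)" using i B(2) by (intro b(2)[of i]) simp_all
      show "bounded_components M (b + 2 * r) c (B \<inter> C i)" using i B(2) by (intro c(2)[of i]) simp_all
      show "B \<inter> A i \<subseteq> mspace M" "B \<inter> C i \<subseteq> mspace M" using A(1) C(1) i by blast+
    qed (use b(1) c(1) r in simp_all)
    moreover have "(B \<inter> A i) \<union> (B \<inter> C i) = B" using B(1) by blast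
    ultimately show "bounded_components M r (2 * (b + c + r)) B" by simp
  qed
  then have "\<forall>i\<le>k. A i \<union> C i \<subseteq> mspace M \<and> fibre_bounded M N f r R (A i \<union> C i)"
    using A(1) C(1) by simp
  moreover have "S \<union> T \<subseteq> (\<Union>i\<le>k. A i \<union> C i)" using A(2) C(2) by blast
  ultimately show ?thesis by (intro exI[of _ "\<lambda>i. A i \<union> C i"]) simp
qed

text \<open>Preimages of bounded sets have asymptotic dimension at most \<open>k\<close> uniformly:
  \<open>b\<close> is chosen before \<open>C\<close> and depends only on \<open>Q\<close> and
  \<open>r\<close>.\<close>

definition fibres_asdim_le :: "'a metric \<Rightarrow> 'b metric \<Rightarrow> ('a \<Rightarrow> 'b) \<Rightarrow> nat \<Rightarrow> bool" where
  "fibres_asdim_le M N f k \<longleftrightarrow>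
     (\<forall>Q. \<forall>r>0. \<exists>b. \<forall>C\<subseteq>mspace N. (\<forall>u\<in>C. \<forall>v\<in>C. mdist N u v \<le> Q) \<longrightarrow>
        (\<exists>A. (\<forall>i\<le>k. A i \<subseteq> mspace M \<and> bounded_components M r b (A i)) \<and>
             {x \<in> mspace M. f x \<in> C} \<subseteq> (\<Union>i\<le>k. A i)))"

text \<open>Every \<open>L\<close>-component of \<open>Y\<close> has diameter at most
  \<open>Q\<close>, so its preimage has a cover with the common bound \<open>b\<close>. Gluing these
  covers is harmless: a set whose image has diameter at most \<open>R \<le> L\<close> lies over one
  component.\<close>

lemma fibre_cover_component:
  assumes F: "fibres_asdim_le M N f k"
    and Y: "Y \<subseteq> mspace N" "bounded_components N L Q Y" and L: "R \<le> L" "0 \<le> L" and r: "0 < r"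
  shows "\<exists>A. (\<forall>i\<le>k. A i \<subseteq> mspace M \<and> fibre_bounded M N f r R (A i)) \<and>
      {x \<in> mspace M. f x \<in> Y} \<subseteq> (\<Union>i\<le>k. A i)"
proof -
  define comp where "comp = (\<lambda>v. {w. (v, w) \<in> chained N L Y})"
  have comp_eq: "comp v = comp w" if "v \<in> Y" "w \<in> Y" "mdist N v w \<le> R" for v w
  proof -
    have vw: "(v, w) \<in> chained N L Y" using that L by (intro chained_step) auto
    show ?thesis unfolding comp_def
      using chained_trans[OF vw] chained_trans[OF chained_sym[OF vw]] by blast
  qed
  obtain b where b: "\<forall>C\<subseteq>mspace N. (\<forall>u\<in>C. \<forall>v\<in>C. mdist N u v \<le> Q) \<longrightarrow>
        (\<exists>A. (\<forall>i\<le>k. A i \<subseteq> mspace M \<and> bounded_components M r b (A i)) \<and>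
             {x \<in> mspace M. f x \<in> C} \<subseteq> (\<Union>i\<le>k. A i))"
    using F[unfolded fibres_asdim_le_def, rule_format, OF r, of Q] by (elim exE) (rule that)
  \<comment> \<open>The cover is chosen per component, not per point, so that points over the same
    component share it.\<close>
  have "\<forall>C. \<exists>A. C \<in> range comp \<longrightarrow> (\<forall>i\<le>k. A i \<subseteq> mspace M \<and> bounded_components M r b (A i)) \<and>
             {x \<in> mspace M. f x \<in> C} \<subseteq> (\<Union>i\<le>k. A i)"
  proof
    fix C
    show "\<exists>A. C \<in> range comp \<longrightarrow> (\<forall>i\<le>k. A i \<subseteq> mspace M \<and> bounded_components M r b (A i)) \<and>
             {x \<in> mspace M. f x \<in> C} \<subseteq> (\<Union>i\<le>k. A i)"
    proof (cases "C \<in> range comp")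
      case True
      then obtain v where C: "C = comp v" by (elim imageE)
      have "\<exists>A. (\<forall>i\<le>k. A i \<subseteq> mspace M \<and> bounded_components M r b (A i)) \<and>
             {x \<in> mspace M. f x \<in> C} \<subseteq> (\<Union>i\<le>k. A i)"
      proof (rule b[rule_format])
        show "C \<subseteq> mspace N" using Y(1) by (auto simp: C comp_def dest: chained_in)
        show "mdist N u w \<le> Q" if "u \<in> C" "w \<in> C" for u w
        proof (rule bounded_componentsD[OF Y(2)])
          have "(v, u) \<in> chained N L Y" "(v, w) \<in> chained N L Y"
            using that by (simp_all add: C comp_def)
          then show "(u, w) \<in> chained N L Y" by (rule chained_trans[OF chained_sym])
        qed
      qed
      then show ?thesis by simp
    qed simp
  qed
  from choice[OF this] obtain A where A': "\<forall>C. C \<in> range comp \<longrightarrow>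
      (\<forall>i\<le>k. A C i \<subseteq> mspace M \<and> bounded_components M r b (A C i)) \<and>
      {x \<in> mspace M. f x \<in> C} \<subseteq> (\<Union>i\<le>k. A C i)"
    by (elim exE) (rule that)
  have A: "bounded_components M r b (A (comp v) i)" if "i \<le> k" for v i
    using A'[rule_format, of "comp v"] that by simp
  define Z where "Z = (\<lambda>i. {x \<in> mspace M. f x \<in> Y \<and> x \<in> A (comp (f x)) i})"
  have "fibre_bounded M N f r R (Z i)" if i: "i \<le> k" for i
  proof (rule fibre_boundedI)
    fix B assume B: "B \<subseteq> Z i" "\<And>x y. x \<in> B \<Longrightarrow> y \<in> B \<Longrightarrow> mdist N (f x) (f y) \<le> R"
    show "bounded_components M r b B"
    proof (rule bounded_componentsI)
      fix x y assume xy: "(x, y) \<in> chained M r B"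
      have BZ: "f z \<in> Y" "z \<in> A (comp (f z)) i" if "z \<in> B" for z
        using B(1) that by (auto simp: Z_def)
      have x: "x \<in> B" using chained_in[OF xy] by simp
      have "B \<subseteq> A (comp (f x)) i"
      proof
        fix z assume z: "z \<in> B"
        have "comp (f z) = comp (f x)" using BZ[OF x] BZ[OF z] B(2)[OF z x] by (intro comp_eq)
        then show "z \<in> A (comp (f x)) i" using BZ(2)[OF z] by simp
      qed
      with xy have "(x, y) \<in> chained M r (A (comp (f x)) i)" using order_refl by (rule chained_mono)
      then show "mdist M x y \<le> b" by (rule bounded_componentsD[OF A[OF i]])
    qed
  qed
  moreover have "{x \<in> mspace M. f x \<in> Y} \<subseteq> (\<Union>i\<le>k. Z i)"
  proof clarify
    fix x assume x: "x \<in> mspace M" "f x \<in> Y"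
    have "f x \<in> comp (f x)" using x(2) Y(1) L by (simp add: comp_def chained_refl)
    then have "x \<in> (\<Union>i\<le>k. A (comp (f x)) i)" using A'[rule_format, of "comp (f x)"] x(1) by blast
    then show "x \<in> (\<Union>i\<le>k. Z i)" using x by (auto simp: Z_def)
  qed
  moreover have "Z i \<subseteq> mspace M" for i by (auto simp: Z_def)
  ultimately show ?thesis by (intro exI[of _ Z]) simp
qed

text \<open>At a fixed scale \<open>R\<close> in \<open>N\<close>, a set of diameter \<open>\<le> R\<close> meets at most one component of each of
  the \<open>n + 1\<close> sets covering \<open>N\<close>; so only \<open>n + 1\<close> coverings of fibres have to be merged, and the
  number of sets stays \<open>k + 1\<close>.\<close>

lemma fibre_cover:
  assumes N: "asdim_le N n" and f: "f ` mspace M \<subseteq> mspace N" and F: "fibres_asdim_le M N f k"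
    and r: "0 < r"
  shows "\<exists>A. (\<forall>i\<le>k. A i \<subseteq> mspace M \<and> fibre_bounded M N f r R (A i)) \<and>
      mspace M \<subseteq> (\<Union>i\<le>k. A i)"
proof -
  \<comment> \<open>\<open>R\<close> may be nonpositive, whereas a scale must be positive.\<close>
  have L: "0 < max 1 R" by simp
  obtain Y Q where Y: "\<And>j. j \<le> n \<Longrightarrow> Y j \<subseteq> mspace N"
    "\<And>j. j \<le> n \<Longrightarrow> bounded_components N (max 1 R) Q (Y j)" "(\<Union>j\<le>n. Y j) = mspace N"
    by (rule asdim_leD[OF N L]) (rule that)
  \<comment> \<open>The preimages of \<open>Y 0\<close>, ..., \<open>Y n\<close> are added one at a
    time.\<close>
  have "\<exists>A. (\<forall>i\<le>k. A i \<subseteq> mspace M \<and> fibre_bounded M N f r R (A i)) \<and>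
      {x \<in> mspace M. \<exists>j<J. f x \<in> Y j} \<subseteq> (\<Union>i\<le>k. A i)" if "J \<le> Suc n" "0 < r" for J r
    using that
  proof (induction J arbitrary: r)
    case 0
    have "fibre_bounded M N f r R {}"
      by (rule fibre_boundedI) (auto intro!: bounded_componentsI dest: chained_in)
    then show ?case by (intro exI[of _ "\<lambda>_. {}"]) simp
  next
    case (Suc J)
    have "{x \<in> mspace M. \<exists>j<Suc J. f x \<in> Y j} =
        {x \<in> mspace M. \<exists>j<J. f x \<in> Y j} \<union> {x \<in> mspace M. f x \<in> Y J}"
      by (auto simp: less_Suc_eq)
    moreover have "\<exists>A. (\<forall>i\<le>k. A i \<subseteq> mspace M \<and> fibre_bounded M N f s R (A i)) \<and>
        {x \<in> mspace M. f x \<in> Y J} \<subseteq> (\<Union>i\<le>k. A i)" if "0 < s" for s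
      using Suc.prems that by (intro fibre_cover_component[OF F Y(1,2)]) simp_all
    ultimately show ?case
      using fibre_cover_Un[OF Suc.IH _ Suc.prems(2)] Suc.prems(1) by simp
  qed
  from this[OF order_refl r] obtain A where
    A: "\<forall>i\<le>k. A i \<subseteq> mspace M \<and> fibre_bounded M N f r R (A i)"
      "{x \<in> mspace M. \<exists>j<Suc n. f x \<in> Y j} \<subseteq> (\<Union>i\<le>k. A i)"
    by (elim exE conjE) (rule that)
  have "\<exists>j<Suc n. f x \<in> Y j" if "x \<in> mspace M" for x
  proof -
    have "f x \<in> (\<Union>j\<le>n. Y j)" using f Y(3) that by blast
    then show ?thesis by (auto simp: less_Suc_eq_le)
  qed
  then have "{x \<in> mspace M. \<exists>j<Suc n. f x \<in> Y j} = mspace M" by blast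
  with A show ?thesis by (intro exI[of _ A]) simp
qed

text \<open>The order of choices matters: the scale \<open>D\<close> determines
  \<open>\<rho>\<close>, the sets \<open>Y i\<close> at scale \<open>\<rho>\<close> determine the
  bound \<open>\<beta>\<close>, and only then are the \<open>A i\<close> chosen, with fibre size
  \<open>\<beta>\<close>.\<close>

theorem asdim_le_fibration:
  assumes f: "coarse_map M N f" and N: "asdim_le N n" and F: "fibres_asdim_le M N f k"
  shows "asdim_le M (n + k)"
proof (rule asdim_leI)
  fix D :: real assume D: "D > 0"
  have fN: "f ` mspace M \<subseteq> mspace N" using f by (simp add: coarse_map_def)
  show "\<exists>Z. (\<forall>i\<le>n + k. Z i \<subseteq> mspace M \<and> (\<exists>b. bounded_components M D b (Z i))) \<and>
      (\<Union>i\<le>n + k. Z i) = mspace M"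
  \<comment> \<open>A point \<open>c\<close> of the target is needed for the constant map
    below.\<close>
  proof (cases "mspace M = {}")
    case True
    then show ?thesis
      by (intro exI[of _ "\<lambda>_. {}"]) (auto intro!: bounded_componentsI dest: chained_in)
  next
    case False
    then obtain c where c: "c \<in> mspace N" using fN by blast
    define m where "m = Suc (n + k)"
    obtain \<rho>' where \<rho>': "\<forall>x\<in>mspace M. \<forall>y\<in>mspace M. mdist M x y \<le> D \<longrightarrow> mdist N (f x) (f y) \<le> \<rho>'"
      using f[unfolded coarse_map_def, THEN conjunct2, rule_format, of D] by (elim exE) (rule that)
    define \<rho> where "\<rho> = max 1 \<rho>'"
    have \<rho>: "0 < \<rho>" "\<And>x y. x \<in> mspace M \<Longrightarrow> y \<in> mspace M \<Longrightarrow> mdist M x y \<le> D \<Longrightarrow> mdist N (f x) (f y) \<le> \<rho>"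
      using \<rho>' by (simp_all add: \<rho>_def le_max_iff_disj)
    \<comment> \<open>For a constant map every set has image of diameter 0, so Kolmogorov's trick
      applies to \<open>N\<close> alone.\<close>
    have "\<exists>Y. (\<forall>i<m. Y i \<subseteq> mspace N \<and> fibre_bounded N N (\<lambda>_. c) \<rho> 0 (Y i)) \<and>
        (\<forall>y\<in>mspace N. m \<le> card {i. i < m \<and> y \<in> Y i} + n)"
    proof (rule kolmogorov)
      show "coarse_map N N (\<lambda>_. c)" using c by (auto simp: coarse_map_def mdist_self)
      fix r R :: real assume r: "0 < r"
      obtain Y b where Y: "\<And>j. j \<le> n \<Longrightarrow> Y j \<subseteq> mspace N"
        "\<And>j. j \<le> n \<Longrightarrow> bounded_components N r b (Y j)" "(\<Union>j\<le>n. Y j) = mspace N"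
        by (rule asdim_leD[OF N r]) (rule that)
      have "fibre_bounded N N (\<lambda>_. c) r R (Y j)" if "j \<le> n" for j
        by (rule fibre_boundedI) (rule bounded_components_mono[OF Y(2)[OF that] _ order_refl order_refl])
      with Y show "\<exists>Y. (\<forall>i\<le>n. Y i \<subseteq> mspace N \<and> fibre_bounded N N (\<lambda>_. c) r R (Y i)) \<and>
          mspace N \<subseteq> (\<Union>i\<le>n. Y i)"
        by (intro exI[of _ Y]) simp
    qed (use \<rho>(1) in \<open>simp_all add: m_def\<close>)
    then obtain Y where Y: "\<forall>i<m. Y i \<subseteq> mspace N \<and> fibre_bounded N N (\<lambda>_. c) \<rho> 0 (Y i)"
        "\<forall>y\<in>mspace N. m \<le> card {i. i < m \<and> y \<in> Y i} + n"
      by (elim exE conjE) (rule that)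
    obtain \<beta> where \<beta>: "0 \<le> \<beta>" "\<And>i B. i \<in> {..<m} \<Longrightarrow> B \<subseteq> Y i \<Longrightarrow>
        (\<And>x y. x \<in> B \<Longrightarrow> y \<in> B \<Longrightarrow> mdist N c c \<le> 0) \<Longrightarrow> bounded_components N \<rho> \<beta> B"
      by (rule fibre_bounded_finite[of "{..<m}" N N "\<lambda>_. c" \<rho> 0 Y, OF finite_lessThan]) (use Y in simp_all)
    have \<beta>Y: "bounded_components N \<rho> \<beta> (Y i)" if "i < m" for i
      using that c by (intro \<beta>(2)[of i]) (simp_all add: mdist_self)
    have "\<exists>A. (\<forall>i<m. A i \<subseteq> mspace M \<and> fibre_bounded M N f D \<beta> (A i)) \<and>
        (\<forall>x\<in>mspace M. m \<le> card {i. i < m \<and> x \<in> A i} + k)"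
      by (rule kolmogorov[OF f fibre_cover[OF N fN F]]) (use D in \<open>simp_all add: m_def\<close>)
    then obtain A where A: "\<forall>i<m. A i \<subseteq> mspace M \<and> fibre_bounded M N f D \<beta> (A i)"
        "\<forall>x\<in>mspace M. m \<le> card {i. i < m \<and> x \<in> A i} + k"
      by (elim exE conjE) (rule that)
    define Z where "Z = (\<lambda>i. {x \<in> A i. f x \<in> Y i})"
    have Z_sub: "Z i \<subseteq> mspace M" if "i < m" for i using A(1) that by (auto simp: Z_def)
    have "\<exists>b. bounded_components M D b (Z i)" if i: "i < m" for i
    proof -
      have "fibre_bounded M N f D \<beta> (A i)" using A(1) i by simp
      then obtain b where b: "\<forall>B\<subseteq>A i. (\<forall>x\<in>B. \<forall>y\<in>B. mdist N (f x) (f y) \<le> \<beta>) \<longrightarrow>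
          bounded_components M D b B"
        unfolding fibre_bounded_def by (elim exE) (rule that)
      have "bounded_components M D b (Z i)"
      proof (rule bounded_componentsI)
        fix x y assume xy: "(x, y) \<in> chained M D (Z i)"
        \<comment> \<open>The component of \<open>x\<close> is the test set for
          \<open>fibre_bounded\<close>: its image lies in one \<open>\<rho>\<close>-component of
          \<open>Y i\<close>, of diameter at most \<open>\<beta>\<close>.\<close>
        let ?P = "{z. (x, z) \<in> chained M D (Z i)}"
        have "bounded_components M D b ?P"
        proof (rule b[rule_format])
          show "?P \<subseteq> A i" by (auto simp: Z_def dest: chained_in)
          fix u v assume "u \<in> ?P" "v \<in> ?P"
          then have "(x, u) \<in> chained M D (Z i)" "(x, v) \<in> chained M D (Z i)" by simp_all
          then have uv: "(u, v) \<in> chained M D (Z i)" by (rule chained_trans[OF chained_sym])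
          have "(f u, f v) \<in> chained N \<rho> (Y i)"
            using uv
          proof (rule chained_image)
            show "mdist N (f x) (f y) \<le> \<rho>" if "x \<in> Z i" "y \<in> Z i" "mdist M x y \<le> D" for x y
              using that Z_sub[OF i] by (intro \<rho>(2)) blast+
          qed (auto simp: Z_def)
          then show "mdist N (f u) (f v) \<le> \<beta>" by (rule bounded_componentsD[OF \<beta>Y[OF i]])
        qed
        moreover have "(x, y) \<in> chained M D ?P"
          using xy Z_sub[OF i] D by (intro chained_component) simp_all
        ultimately show "mdist M x y \<le> b" by (rule bounded_componentsD)
      qed
      then show ?thesis ..
    qed
    moreover have "\<exists>i<m. x \<in> Z i" if x: "x \<in> mspace M" for x
    proof (rule ccontr)
      assume no: "\<not> (\<exists>i<m. x \<in> Z i)"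
      \<comment> \<open>Pigeonhole: at least \<open>n + 1\<close> and at least \<open>k + 1\<close>
        indices out of \<open>n + k + 1\<close> cannot be disjoint.\<close>
      let ?I = "{i. i < m \<and> x \<in> A i}" and ?J = "{i. i < m \<and> f x \<in> Y i}"
      have "f x \<in> mspace N" using fN x by blast
      then have "m \<le> card ?I + k" "m \<le> card ?J + n" using A(2) Y(2) x by blast+
      moreover have "?I \<inter> ?J = {}" using no by (auto simp: Z_def)
      then have "card (?I \<union> ?J) = card ?I + card ?J" by (intro card_Un_disjoint) auto
      moreover have "card (?I \<union> ?J) \<le> card {..<m}" by (intro card_mono) auto
      ultimately show False by (simp add: m_def)
    qed
    then have "(\<Union>i\<le>n + k. Z i) = mspace M"
      using Z_sub by (fastforce simp: m_def less_Suc_eq_le)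
    ultimately show ?thesis
      using Z_sub by (intro exI[of _ Z]) (simp add: m_def less_Suc_eq_le)
  qed
qed


section \<open>Word metrics\<close>

context group
begin

lemma finite_word_ball:
  assumes "finite S" "S \<subseteq> carrier G" "generate G S = carrier G"
  shows "finite {g \<in> carrier G. word_length G S g \<le> l}"
proof (rule finite_subset)
  let ?W = "{ws. set ws \<subseteq> S \<union> m_inv G ` S \<and> length ws \<le> l}"
  show "finite ((\<lambda>ws. foldr (\<otimes>) ws \<one>) ` ?W)"
    using assms(1) by (intro finite_imageI finite_lists_length_le) simp
  show "{g \<in> carrier G. word_length G S g \<le> l} \<subseteq> (\<lambda>ws. foldr (\<otimes>) ws \<one>) ` ?W"
  proof clarify
    fix g assume g: "g \<in> carrier G" "word_length G S g \<le> l"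
    then have "g \<in> generate G S" using assms(3) by simp
    from word_length_word[OF assms(2) this] obtain ws where "length ws = word_length G S g"
      "set ws \<subseteq> S \<union> m_inv G ` S" "foldr (\<otimes>) ws \<one> = g" .
    with g(2) show "g \<in> (\<lambda>ws. foldr (\<otimes>) ws \<one>) ` ?W" by (intro image_eqI[of _ _ ws]) auto
  qed
qed

text \<open>Finite generation makes balls finite, so any function is bounded on them. It is applied
  to the length of the image under \<open>\<phi>\<close> and to the length of a chosen lift.\<close>

lemma bounded_on_word_ball:
  fixes h :: "'a \<Rightarrow> real"
  assumes "finite S" "S \<subseteq> carrier G" "generate G S = carrier G"
  obtains c where "0 \<le> c" "\<And>g. g \<in> carrier G \<Longrightarrow> real (word_length G S g) \<le> r \<Longrightarrow> h g \<le> c"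
proof
  \<comment> \<open>Lengths are natural numbers, so the radius may be rounded down.\<close>
  let ?B = "h ` {g \<in> carrier G. word_length G S g \<le> nat \<lfloor>r\<rfloor>}"
  have fin: "finite (insert 0 ?B)" using finite_word_ball[OF assms] by simp
  show "0 \<le> Max (insert 0 ?B)" using fin by (intro Max_ge) simp_all
  show "h g \<le> Max (insert 0 ?B)" if "g \<in> carrier G" "real (word_length G S g) \<le> r" for g
  proof (rule Max_ge[OF fin])
    have "word_length G S g \<le> nat \<lfloor>r\<rfloor>" using that(2) by (rule le_nat_floor)
    with that(1) show "h g \<in> insert 0 ?B" by blast
  qed
qed

lemma word_dist_mult_left:
  assumes "g \<in> carrier G" "x \<in> carrier G" "y \<in> carrier G"
  shows "word_dist G S (g \<otimes> x) (g \<otimes> y) = word_dist G S x y"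
proof -
  have "inv (g \<otimes> x) \<otimes> (g \<otimes> y) = inv x \<otimes> (inv g \<otimes> (g \<otimes> y))"
    using assms by (simp add: inv_mult_group m_assoc)
  also have "inv g \<otimes> (g \<otimes> y) = y" using assms by (simp flip: m_assoc)
  finally show ?thesis using assms by (simp add: word_dist_def)
qed

end

section \<open>A surjective homomorphism as a coarse map with controlled fibres\<close>

context
  fixes G :: "('a, 'm) monoid_scheme" and H :: "('b, 'l) monoid_scheme"
    and \<phi> :: "'a \<Rightarrow> 'b" and S :: "'a set" and T :: "'b set"
  assumes G: "group G" and H: "group H" and \<phi>: "\<phi> \<in> epi G H"
    and S: "finite S" "S \<subseteq> carrier G" "generate G S = carrier G"
    and T: "finite T" "T \<subseteq> carrier H" "generate H T = carrier H"
begin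

interpretation G: group G by fact
interpretation H: group H by fact
interpretation \<phi>: group_hom G H \<phi>
  using \<phi> by unfold_locales (simp add: epi_def)

lemma \<phi>_surj: "\<phi> ` carrier G = carrier H"
  using \<phi> by (simp add: epi_def)

lemmas word_metric_simps =
  G.mspace_word_metric[OF S(2,3)] G.mdist_word_metric[OF S(2,3)]
  H.mspace_word_metric[OF T(2,3)] H.mdist_word_metric[OF T(2,3)]

lemma word_dist_hom:
  assumes "x \<in> carrier G" "y \<in> carrier G"
  shows "word_dist H T (\<phi> x) (\<phi> y) = word_length H T (\<phi> (inv\<^bsub>G\<^esub> x \<otimes>\<^bsub>G\<^esub> y))"
  using assms by (simp add: word_dist_def)

text \<open>The distance of \<open>x\<close> and \<open>y\<close> is the length of
  \<open>inv x * y\<close>, so it suffices to bound the length of \<open>\<phi> g\<close> for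
  \<open>g\<close> in a ball about the identity.\<close>

lemma coarse_map_hom: "coarse_map (word_metric G S) (word_metric H T) \<phi>"
  unfolding coarse_map_def word_metric_simps
proof (intro conjI allI)
  show "\<phi> ` carrier G \<subseteq> carrier H" using \<phi>_surj by simp
  fix r :: real
  obtain c where c: "\<And>g. g \<in> carrier G \<Longrightarrow> real (word_length G S g) \<le> r \<Longrightarrow> real (word_length H T (\<phi> g)) \<le> c"
    by (rule G.bounded_on_word_ball[OF S, of r "\<lambda>g. real (word_length H T (\<phi> g))"]) (rule that)
  show "\<exists>s. \<forall>x\<in>carrier G. \<forall>y\<in>carrier G. word_dist G S x y \<le> r \<longrightarrow> word_dist H T (\<phi> x) (\<phi> y) \<le> s"
  proof (intro exI[of _ c] ballI impI)
    fix x y assume xy: "x \<in> carrier G" "y \<in> carrier G" "word_dist G S x y \<le> r"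
    then have "real (word_length G S (inv\<^bsub>G\<^esub> x \<otimes>\<^bsub>G\<^esub> y)) \<le> r" by (simp add: word_dist_def)
    with xy(1,2) show "word_dist H T (\<phi> x) (\<phi> y) \<le> c" by (simp only: word_dist_hom) (rule c, simp_all)
  qed
qed

text \<open>The preimage of a bounded set lies in a neighbourhood, of controlled radius, of a coset of the
  kernel, which is isometric to the kernel.\<close>

lemma fibres_asdim_le_hom:
  assumes K: "asdim_le (submetric (word_metric G S) (kernel G H \<phi>)) k"
  shows "fibres_asdim_le (word_metric G S) (word_metric H T) \<phi> k"
  unfolding fibres_asdim_le_def
proof (intro allI impI)
  fix Q r :: real assume r: "0 < r"
  let ?M = "word_metric G S" and ?K = "submetric (word_metric G S) (kernel G H \<phi>)"
  have lift: "\<exists>g\<in>carrier G. \<phi> g = h" if "h \<in> carrier H" for h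
    using \<phi>_surj that by (metis imageE)
  \<comment> \<open>A set-theoretic section of \<open>\<phi>\<close>; \<open>c\<close> bounds the
    lengths of the lifts of the \<open>Q\<close>-ball of \<open>H\<close>.\<close>
  define \<sigma> where "\<sigma> = (\<lambda>h. SOME g. g \<in> carrier G \<and> \<phi> g = h)"
  have \<sigma>: "\<sigma> h \<in> carrier G" "\<phi> (\<sigma> h) = h" if "h \<in> carrier H" for h
    using someI_ex[OF lift[OF that, unfolded Bex_def]] by (simp_all add: \<sigma>_def)
  obtain c where c: "0 \<le> c" "\<And>h. h \<in> carrier H \<Longrightarrow> real (word_length H T h) \<le> Q \<Longrightarrow>
      real (word_length G S (\<sigma> h)) \<le> c"
    by (rule H.bounded_on_word_ball[OF T, of Q "\<lambda>h. real (word_length G S (\<sigma> h))"]) (rule that)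
  \<comment> \<open>Projecting two points to the coset costs \<open>c\<close> at either end.\<close>
  have r2: "0 < r + 2 * c" using r c by simp
  obtain U b where U: "\<And>i. i \<le> k \<Longrightarrow> U i \<subseteq> mspace ?K"
    "\<And>i. i \<le> k \<Longrightarrow> bounded_components ?K (r + 2 * c) b (U i)" "(\<Union>i\<le>k. U i) = mspace ?K"
    by (rule asdim_leD[OF K r2]) (rule that)
  have K_eq: "mspace ?K = kernel G H \<phi>" "mdist ?K = word_dist G S"
    by (auto simp: word_metric_simps kernel_def)
  have "\<exists>A. (\<forall>i\<le>k. A i \<subseteq> carrier G \<and> bounded_components ?M r (b + 2 * c) (A i)) \<and>
        {x \<in> carrier G. \<phi> x \<in> C} \<subseteq> (\<Union>i\<le>k. A i)"
    if C: "C \<subseteq> carrier H" "\<And>u v. u \<in> C \<Longrightarrow> v \<in> C \<Longrightarrow> word_dist H T u v \<le> Q" for C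
  proof (cases "C = {}")
    case True
    then show ?thesis
      by (intro exI[of _ "\<lambda>_. {}"]) (auto intro!: bounded_componentsI dest: chained_in)
  next
    case False
    then obtain g where g: "g \<in> carrier G" "\<phi> g \<in> C" using lift C(1) by blast
    \<comment> \<open>The cover of the kernel is translated by \<open>g\<close> and thickened by
      \<open>c\<close>.\<close>
    define A where "A = (\<lambda>i. {x \<in> carrier G. \<exists>z\<in>U i. word_dist G S x (g \<otimes>\<^bsub>G\<^esub> z) \<le> c})"
    have "bounded_components ?M r (b + 2 * c) (A i)" if i: "i \<le> k" for i
    proof -
      have "\<forall>x\<in>A i. \<exists>z. z \<in> U i \<and> word_dist G S x (g \<otimes>\<^bsub>G\<^esub> z) \<le> c" by (auto simp: A_def)
      from bchoice[OF this] obtain z where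
        z: "\<forall>x\<in>A i. z x \<in> U i \<and> word_dist G S x (g \<otimes>\<^bsub>G\<^esub> z x) \<le> c" by (elim exE) (rule that)
      have Ui: "u \<in> carrier G" if "u \<in> U i" for u
        using U(1)[OF i] that K_eq(1) by (auto simp: kernel_def)
      show ?thesis
      proof (rule bounded_components_near[OF U(2)[OF i], of z])
        show "z ` A i \<subseteq> U i" using z by blast
        fix x y assume xy: "x \<in> A i" "y \<in> A i"
        let ?x = "g \<otimes>\<^bsub>G\<^esub> z x" and ?y = "g \<otimes>\<^bsub>G\<^esub> z y"
        have mem: "x \<in> carrier G" "y \<in> carrier G" "z x \<in> carrier G" "z y \<in> carrier G"
          using xy z Ui by (auto simp: A_def)
        then have mem': "?x \<in> carrier G" "?y \<in> carrier G" using g by simp_all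
        have eq: "word_dist G S ?x ?y = word_dist G S (z x) (z y)"
          using g(1) mem by (intro G.word_dist_mult_left)
        note tri = mdist_triangle[of _ ?M, unfolded word_metric_simps]
        have "word_dist G S x y \<le> word_dist G S x ?x + word_dist G S ?x y"
          "word_dist G S ?x y \<le> word_dist G S ?x ?y + word_dist G S ?y y"
          "word_dist G S ?x ?y \<le> word_dist G S ?x x + word_dist G S x ?y"
          "word_dist G S x ?y \<le> word_dist G S x y + word_dist G S y ?y"
          using mem mem' by (simp_all add: tri)
        moreover have "word_dist G S x ?x = word_dist G S ?x x" "word_dist G S y ?y = word_dist G S ?y y"
          using mdist_commute[of ?M, unfolded word_metric_simps] by blast+
        moreover have "word_dist G S x ?x \<le> c" "word_dist G S y ?y \<le> c" using z xy by blast+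
        ultimately have "\<bar>word_dist G S x y - word_dist G S (z x) (z y)\<bar> \<le> 2 * c"
          unfolding eq by linarith
        then show "\<bar>mdist ?M x y - mdist ?K (z x) (z y)\<bar> \<le> 2 * c"
          by (simp only: K_eq word_metric_simps)
      qed simp
    qed
    moreover have "x \<in> (\<Union>i\<le>k. A i)" if x: "x \<in> carrier G" "\<phi> x \<in> C" for x
    proof -
      \<comment> \<open>The lift \<open>s\<close> corrects \<open>inv g * x\<close> to an element
        \<open>z\<close> of the kernel with \<open>g * z * s = x\<close>; hence \<open>x\<close> is
        within the length of \<open>s\<close>, at most \<open>c\<close>, of the coset point
        \<open>g * z\<close>.\<close>
      define s where "s = \<sigma> (\<phi> (inv\<^bsub>G\<^esub> g \<otimes>\<^bsub>G\<^esub> x))"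
      define z where "z = inv\<^bsub>G\<^esub> g \<otimes>\<^bsub>G\<^esub> x \<otimes>\<^bsub>G\<^esub> inv\<^bsub>G\<^esub> s"
      have s: "s \<in> carrier G" "\<phi> s = \<phi> (inv\<^bsub>G\<^esub> g \<otimes>\<^bsub>G\<^esub> x)"
        unfolding s_def using x g by (intro \<sigma>; simp)+
      have "real (word_length H T (\<phi> (inv\<^bsub>G\<^esub> g \<otimes>\<^bsub>G\<^esub> x))) \<le> Q"
        using C(2)[OF g(2) x(2)] x g by (simp only: word_dist_hom)
      then have "real (word_length G S s) \<le> c"
        unfolding s_def using x g by (intro c(2)) simp_all
      moreover have z: "z \<in> carrier G" "\<phi> z = \<one>\<^bsub>H\<^esub>"
        using x g s by (simp_all add: z_def)
      moreover have "inv\<^bsub>G\<^esub> (g \<otimes>\<^bsub>G\<^esub> z) \<otimes>\<^bsub>G\<^esub> x = s"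
      proof -
        have "g \<otimes>\<^bsub>G\<^esub> z = x \<otimes>\<^bsub>G\<^esub> inv\<^bsub>G\<^esub> s"
          using x(1) g(1) s(1) by (simp add: z_def G.m_assoc[symmetric])
        then show ?thesis using x(1) s(1) by (simp add: G.inv_mult_group G.m_assoc)
      qed
      ultimately have "word_dist G S (g \<otimes>\<^bsub>G\<^esub> z) x \<le> c"
        using x(1) g(1) by (simp add: word_dist_def)
      then have "word_dist G S x (g \<otimes>\<^bsub>G\<^esub> z) \<le> c"
        using mdist_commute[of ?M, unfolded word_metric_simps] by metis
      moreover have "z \<in> (\<Union>i\<le>k. U i)" using z unfolding U(3) K_eq by (simp add: kernel_def)
      ultimately show ?thesis using x(1) by (auto simp: A_def)
    qed
    moreover have "A i \<subseteq> carrier G" for i by (auto simp: A_def)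
    ultimately show ?thesis by (intro exI[of _ A]) blast
  qed
  then show "\<exists>b. \<forall>C\<subseteq>mspace (word_metric H T). (\<forall>u\<in>C. \<forall>v\<in>C. mdist (word_metric H T) u v \<le> Q) \<longrightarrow>
        (\<exists>A. (\<forall>i\<le>k. A i \<subseteq> mspace ?M \<and> bounded_components ?M r b (A i)) \<and>
             {x \<in> mspace ?M. \<phi> x \<in> C} \<subseteq> (\<Union>i\<le>k. A i))"
    unfolding word_metric_simps by (intro exI[of _ "b + 2 * c"]) simp
qed

end

theorem theorem7:
  fixes G :: "('a, 'm) monoid_scheme" and H :: "('b, 'l) monoid_scheme"
    and \<phi> :: "'a \<Rightarrow> 'b" and S :: "'a set" and T :: "'b set" and n k :: nat
  assumes "group G" and "group H"
    and "\<phi> \<in> epi G H"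
    and "finite S" and "S \<subseteq> carrier G" and "generate G S = carrier G"
    and "finite T" and "T \<subseteq> carrier H" and "generate H T = carrier H"
    and "asdim (word_metric H T) \<le> enat n"
    and "asdim (submetric (word_metric G S) (kernel G H \<phi>)) \<le> enat k"
  shows "asdim (word_metric G S) \<le> enat (n + k)"
  using asdim_le_fibration[OF coarse_map_hom[OF assms(1-9)] _ fibres_asdim_le_hom[OF assms(1-9)]]
    assms(10,11)
  by (simp only: asdim_le_enat_iff)

end
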